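(* Let $G$ be a graph on $n$ vertices. Then $$\frac12\mathcal{E}(G)\ge n-\chi_f(\overline{G}).$$
   Context: Graphs are finite, simple, undirected. $\mathcal{E}(G)$ is the energy of $G$: the sum of the absolute values of the eigenvalues of the adjacency matrix of $G$. $\overline{G}$ is the complement of $G$. Let $\mathcal{C}$ be the set of cliques of $G$ and let $M$ be the $n\times|\mathcal{C}|$ matrix with $M_{vU}=1$ if vertex $v\in U$ and $0$ otherwise. The fractional chromatic number of $\overline{G}$ is $\chi_f(\overline{G})=\min\{\langle \mathbf{1},y\rangle : My=\mathbf{1},\ y\ge 0\}$. *)

theory Defs
  imports
    "HOL-Library.Ramsey"
    "HOL-Analysis.Function_Topology"
    "HOL-Combinatorics.Permutations"
    "Jordan_Normal_Form.Spectral_Radius"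
begin

text \<open>A finite simple undirected graph is given by its vertex set \<open>V\<close> and its edge set \<open>E\<close>, a set
  of two-element subsets of \<open>V\<close>. The predicates \<open>clique\<close> and \<open>indep\<close> come from
  \<^theory>\<open>HOL-Library.Ramsey\<close>.\<close>

definition fin_graph :: "'a set \<Rightarrow> 'a set set \<Rightarrow> bool" where
  "fin_graph V E \<longleftrightarrow> finite V \<and> E \<subseteq> [V]\<^bsup>2\<^esup>"

definition compl_edges :: "'a set \<Rightarrow> 'a set set \<Rightarrow> 'a set set" where
  "compl_edges V E = [V]\<^bsup>2\<^esup> - E"

lemma fin_graph_compl: "fin_graph V E \<Longrightarrow> fin_graph V (compl_edges V E)"
  by (auto simp: fin_graph_def compl_edges_def)


section \<open>Energy\<close>

text \<open>Adjacency matrix with respect to an enumeration \<open>vs\<close> of the vertices. Diagonal entries vanish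
  because a singleton is never an edge. The entries are complex so that the characteristic
  polynomial has all \<open>n\<close> roots, counted with multiplicity.\<close>

definition adj_matrix :: "'a set set \<Rightarrow> 'a list \<Rightarrow> complex mat" where
  "adj_matrix E vs =
     mat (length vs) (length vs) (\<lambda>(i, j). if {vs ! i, vs ! j} \<in> E then 1 else 0)"

text \<open>Sum of the absolute values of the eigenvalues, with multiplicity.\<close>

definition abs_eigenvalue_sum :: "complex mat \<Rightarrow> real" where
  "abs_eigenvalue_sum A = (\<Sum>\<mu>\<in>spectrum A. real (order \<mu> (char_poly A)) * cmod \<mu>)"

text \<open>The enumeration is an arbitrary one; \<open>energy_eq\<close> below shows that the choice is irrelevant.\<close>

definition energy :: "'a set \<Rightarrow> 'a set set \<Rightarrow> real" where
  "energy V E = abs_eigenvalue_sum (adj_matrix E (SOME vs. distinct vs \<and> set vs = V))"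

lemma adj_matrix_carrier [simp]: "adj_matrix E vs \<in> carrier_mat (length vs) (length vs)"
  by (simp add: adj_matrix_def)

lemma char_poly_permute:
  fixes A :: "'b :: comm_ring_1 mat"
  assumes A: "A \<in> carrier_mat n n" and p: "p permutes {0..<n}"
  shows "char_poly (mat n n (\<lambda>(i, j). A $$ (p i, p j))) = char_poly A"
proof -
  define C where "C = char_poly_matrix A"
  have C: "C \<in> carrier_mat n n" using A by (simp add: C_def)
  define C1 where "C1 = mat n n (\<lambda>(i, j). C $$ (p i, j))"
  have C1: "C1 \<in> carrier_mat n n" by (simp add: C1_def)
  define C2 where "C2 = mat n n (\<lambda>(i, j). C1\<^sup>T $$ (p i, j))"
  have C2: "C2 \<in> carrier_mat n n" by (simp add: C2_def)
  have pn: "p i < n \<longleftrightarrow> i < n" for i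
    using permutes_in_image[OF p, of i] by auto
  have pinj: "p i = p j \<longleftrightarrow> i = j" for i j
    using permutes_inj[OF p] by (auto dest: injD)
  have "char_poly_matrix (mat n n (\<lambda>(i, j). A $$ (p i, p j))) = C2\<^sup>T"
    by (rule eq_matI) (use A in \<open>auto simp: C2_def C1_def C_def char_poly_matrix_def pn pinj\<close>)
  hence "char_poly (mat n n (\<lambda>(i, j). A $$ (p i, p j))) = det (C2\<^sup>T)"
    by (simp add: char_poly_def)
  also have "\<dots> = det C2" by (rule det_transpose[OF C2])
  also have "\<dots> = signof p * det (C1\<^sup>T)"
    unfolding C2_def by (rule det_permute_rows[OF _ p]) (use C1 in simp)
  also have "det (C1\<^sup>T) = det C1" by (rule det_transpose[OF C1])
  also have "det C1 = signof p * det C"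
    unfolding C1_def by (rule det_permute_rows[OF C p])
  also have "signof p * (signof p * det C) = det C"
    by (simp add: sign_def)
  finally show ?thesis by (simp add: C_def char_poly_def)
qed

lemma abs_eigenvalue_sum_adj_matrix_cong:
  assumes "distinct vs" "distinct ws" "set vs = set ws"
  shows "abs_eigenvalue_sum (adj_matrix E vs) = abs_eigenvalue_sum (adj_matrix E ws)"
proof -
  let ?n = "length ws"
  have "mset vs = mset ws" using assms by (simp add: set_eq_iff_mset_eq_distinct)
  then obtain p where p: "p permutes {..<?n}" and vs: "permute_list p ws = vs"
    by (rule mset_eq_permutation)
  have len: "length vs = ?n" using vs by auto
  have p0: "p permutes {0..<?n}" using p by (simp add: atLeast0LessThan)
  have pn: "p i < ?n \<longleftrightarrow> i < ?n" for i
    using permutes_in_image[OF p, of i] by auto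
  have "adj_matrix E vs = mat ?n ?n (\<lambda>(i, j). adj_matrix E ws $$ (p i, p j))"
    by (rule eq_matI)
      (auto simp: adj_matrix_def len pn permute_list_nth[OF p] simp flip: vs)
  hence cp: "char_poly (adj_matrix E vs) = char_poly (adj_matrix E ws)"
    using char_poly_permute[OF adj_matrix_carrier p0] by simp
  show ?thesis
    by (simp add: abs_eigenvalue_sum_def spectrum_root_char_poly[OF adj_matrix_carrier] cp)
qed

lemma energy_eq:
  assumes "distinct vs" "set vs = V"
  shows "energy V E = abs_eigenvalue_sum (adj_matrix E vs)"
proof -
  have "distinct (SOME vs. distinct vs \<and> set vs = V) \<and> set (SOME vs. distinct vs \<and> set vs = V) = V"
    by (rule someI[of _ vs]) (use assms in simp)
  thus ?thesis
    unfolding energy_def using assms by (intro abs_eigenvalue_sum_adj_matrix_cong) auto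
qed


section \<open>Fractional chromatic number\<close>

definition cliques :: "'a set \<Rightarrow> 'a set set \<Rightarrow> 'a set set" where
  "cliques V E = {U. U \<subseteq> V \<and> clique U E}"

definition indep_sets :: "'a set \<Rightarrow> 'a set set \<Rightarrow> 'a set set" where
  "indep_sets V E = {U. U \<subseteq> V \<and> indep U E}"

text \<open>Feasible points of the linear program \<open>M y = 1\<close>, \<open>y \<ge> 0\<close>, where \<open>M\<close> is the vertex-set
  incidence matrix of the set family \<open>\<C>\<close>. A vector indexed by \<open>\<C>\<close> is a function whose values
  outside \<open>\<C>\<close> are irrelevant.\<close>

definition frac_partitions :: "'a set \<Rightarrow> 'a set set \<Rightarrow> ('a set \<Rightarrow> real) set" where
  "frac_partitions V \<C> =
     {y. (\<forall>v\<in>V. (\<Sum>U\<in>\<C>. of_bool (v \<in> U) * y U) = 1) \<and> (\<forall>U\<in>\<C>. 0 \<le> y U)}"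

definition frac_partition_number :: "'a set \<Rightarrow> 'a set set \<Rightarrow> real" where
  "frac_partition_number V \<C> = Inf ((\<lambda>y. \<Sum>U\<in>\<C>. y U) ` frac_partitions V \<C>)"

definition frac_chromatic :: "'a set \<Rightarrow> 'a set set \<Rightarrow> real" where
  "frac_chromatic V E = frac_partition_number V (indep_sets V E)"

text \<open>The colour classes of the complement are the cliques of the graph.\<close>

lemma indep_sets_compl: "indep_sets V (compl_edges V E) = cliques V E"
proof -
  have "{v, w} \<in> [V]\<^bsup>2\<^esup>" if "U \<subseteq> V" "v \<in> U" "w \<in> U" "v \<noteq> w" for U v w
    using that by (auto simp: nsets_def card_insert_if)
  thus ?thesis
    unfolding indep_sets_def cliques_def indep_def clique_def compl_edges_def by blast
qed

lemma frac_chromatic_compl: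
  "frac_chromatic V (compl_edges V E) =
     Inf {(\<Sum>U\<in>cliques V E. y U) | y.
       (\<forall>v\<in>V. (\<Sum>U\<in>cliques V E. of_bool (v \<in> U) * y U) = 1) \<and> (\<forall>U\<in>cliques V E. 0 \<le> y U)}"
  by (simp add: frac_chromatic_def indep_sets_compl frac_partition_number_def
      frac_partitions_def setcompr_eq_image)

text \<open>The infimum is a minimum.\<close>

lemma frac_partition_number_attained:
  assumes "finite V" and sub: "\<C> \<subseteq> Pow V" and sing: "\<And>v. v \<in> V \<Longrightarrow> {v} \<in> \<C>"
  shows "\<exists>y\<in>frac_partitions V \<C>. (\<Sum>U\<in>\<C>. y U) = frac_partition_number V \<C> \<and>
           (\<forall>z\<in>frac_partitions V \<C>. (\<Sum>U\<in>\<C>. y U) \<le> (\<Sum>U\<in>\<C>. z U))"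
proof -
  have fin: "finite \<C>" using assms(1) sub by (meson finite_Pow_iff finite_subset)
  let ?f = "\<lambda>y :: 'a set \<Rightarrow> real. \<Sum>U\<in>\<C>. y U"
  let ?B = "\<lambda>U. if U \<in> \<C> \<and> U \<noteq> {} then {0..1} else {0 :: real}"
  define K where "K = PiE UNIV ?B \<inter> {y. \<forall>v\<in>V. (\<Sum>U\<in>\<C>. of_bool (v \<in> U) * y U) = 1}"
  have cont: "continuous_on UNIV (\<lambda>y :: 'a set \<Rightarrow> real. \<Sum>U\<in>\<C>. c U * y U)" for c
    by (intro continuous_on_sum continuous_on_mult continuous_on_const
        continuous_on_product_coordinates)
  have "compact (PiE UNIV ?B)"
    unfolding compactin_euclidean_iff[symmetric] euclidean_product_topology[symmetric]
    by (simp add: compactin_PiE)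
  moreover have "closed {y. \<forall>v\<in>V. (\<Sum>U\<in>\<C>. of_bool (v \<in> U) * y U) = (1 :: real)}"
    unfolding Ball_def by (intro closed_Collect_all closed_Collect_imp open_Collect_const
        closed_Collect_eq cont continuous_on_const)
  ultimately have "compact K" unfolding K_def by (rule compact_Int_closed)
  have "(\<lambda>U. of_bool (\<exists>v\<in>V. U = {v})) \<in> K"
  proof -
    have "(\<Sum>U\<in>\<C>. of_bool (v \<in> U) * of_bool (\<exists>w\<in>V. U = {w})) = (1 :: real)" if "v \<in> V" for v
    proof -
      have "(\<Sum>U\<in>\<C>. of_bool (v \<in> U) * of_bool (\<exists>w\<in>V. U = {w})) =
              (\<Sum>U\<in>\<C>. if U = {v} then 1 else (0 :: real))"
        using that by (intro sum.cong) auto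
      thus ?thesis using fin sing[OF that] by simp
    qed
    thus ?thesis using sing by (auto simp: K_def PiE_iff)
  qed
  hence "K \<noteq> {}" by blast
  moreover have "continuous_on K ?f"
    using cont[of "\<lambda>_. 1"] by (auto intro: continuous_on_subset)
  ultimately obtain y where y: "y \<in> K" "\<And>z. z \<in> K \<Longrightarrow> ?f y \<le> ?f z"
    using continuous_attains_inf[OF \<open>compact K\<close>] by blast
  have yP: "y \<in> frac_partitions V \<C>"
  proof -
    have "0 \<le> y U" for U
    proof -
      have "y \<in> PiE UNIV ?B" using y(1) by (simp add: K_def)
      hence "y U \<in> ?B U" by (rule PiE_mem) simp
      thus ?thesis by (simp split: if_splits)
    qed
    thus ?thesis using y(1) by (auto simp: K_def frac_partitions_def)
  qed
  have le: "?f y \<le> ?f z" if z: "z \<in> frac_partitions V \<C>" for z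
  proof -
    define z' where "z' U = (if U \<in> \<C> \<and> U \<noteq> {} then z U else 0)" for U
    have z0: "0 \<le> z U" if "U \<in> \<C>" for U using z that by (auto simp: frac_partitions_def)
    have z1: "(\<Sum>U\<in>\<C>. of_bool (v \<in> U) * z U) = 1" if "v \<in> V" for v
      using z that by (auto simp: frac_partitions_def)
    have "z U \<le> 1" if U: "U \<in> \<C>" "U \<noteq> {}" for U
    proof -
      obtain v where v: "v \<in> U" "v \<in> V" using U sub by blast
      have "of_bool (v \<in> U) * z U \<le> (\<Sum>U\<in>\<C>. of_bool (v \<in> U) * z U)"
        by (rule member_le_sum) (use U fin z0 in auto)
      thus ?thesis using v z1 by simp
    qed
    moreover have "(\<Sum>U\<in>\<C>. of_bool (v \<in> U) * z' U) = (\<Sum>U\<in>\<C>. of_bool (v \<in> U) * z U)" for v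
      by (intro sum.cong) (auto simp: z'_def)
    ultimately have "z' \<in> K" using z0 z1 by (auto simp: K_def PiE_iff z'_def)
    hence "?f y \<le> ?f z'" by (rule y(2))
    also have "\<dots> \<le> ?f z" by (rule sum_mono) (use z0 in \<open>auto simp: z'_def\<close>)
    finally show ?thesis .
  qed
  have "frac_partition_number V \<C> = ?f y"
    unfolding frac_partition_number_def using yP le by (intro cInf_eq_minimum) auto
  thus ?thesis using yP le by auto
qed

lemma frac_chromatic_attained:
  assumes "finite V"
  shows "\<exists>y\<in>frac_partitions V (indep_sets V E).
           (\<Sum>U\<in>indep_sets V E. y U) = frac_chromatic V E \<and>
           (\<forall>z\<in>frac_partitions V (indep_sets V E).
              (\<Sum>U\<in>indep_sets V E. y U) \<le> (\<Sum>U\<in>indep_sets V E. z U))"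
  unfolding frac_chromatic_def
  by (rule frac_partition_number_attained[OF assms]) (auto simp: indep_sets_def indep_def)

end

theory Submission
  imports Defs "HOL-Analysis.Convex"
begin

text \<open>Let \<open>y\<close> be an optimal fractional partition into cliques and
  \<open>X = (\<Sum>U. (y U / \<bar>U\<bar>) 1\<^sub>U 1\<^sub>U\<^sup>T)\<close>. By the Cauchy--Schwarz inequality \<open>0 \<le> X \<le> I\<close>, and
  \<open>tr (A X) = (\<Sum>U. y U (\<bar>U\<bar> - 1)) = n - (\<Sum>U. y U)\<close> since every \<open>U\<close> is a clique. In an
  orthonormal eigenbasis of the adjacency matrix \<open>A\<close> this trace is \<open>\<Sum>k. d k * c k\<close>, where the
  \<open>d k\<close> are the eigenvalues and the \<open>c k \<in> [0, 1]\<close> are the diagonal entries of \<open>X\<close>. It is thus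
  at most the sum of the positive eigenvalues, which is half the energy because \<open>tr A = 0\<close>.\<close>

section \<open>The spectral theorem for Hermitian matrices\<close>

lemma dim_mat_adjoint [simp]:
  "dim_row (mat_adjoint A) = dim_col A" "dim_col (mat_adjoint A) = dim_row A"
  by (simp_all add: mat_adjoint_def)

lemma index_mat_adjoint [simp]:
  "i < dim_col A \<Longrightarrow> j < dim_row A \<Longrightarrow> mat_adjoint A $$ (i, j) = conjugate (A $$ (j, i))"
  by (simp add: mat_adjoint_def mat_of_rows_index)

lemma mat_adjoint_carrier [simp, intro]:
  "A \<in> carrier_mat m n \<Longrightarrow> mat_adjoint A \<in> carrier_mat n m"
  by (intro carrier_matI) auto

lemma mat_adjoint_mult:
  fixes A B :: "complex mat"
  assumes "A \<in> carrier_mat m k" "B \<in> carrier_mat k n"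
  shows "mat_adjoint (A * B) = mat_adjoint B * mat_adjoint A"
  using assms by (intro eq_matI) (auto simp: scalar_prod_def intro!: sum.cong)

lemma mat_adjoint_adjoint [simp]: "mat_adjoint (mat_adjoint A) = (A :: complex mat)"
  by (intro eq_matI) auto

lemma mat_adjoint_mult_self_index:
  fixes A :: "complex mat"
  assumes "A \<in> carrier_mat m n" "i < n" "j < n"
  shows "(mat_adjoint A * A) $$ (i, j) = (\<Sum>k<m. cnj (A $$ (k, i)) * A $$ (k, j))"
  using assms by (auto simp: scalar_prod_def atLeast0LessThan intro!: sum.cong)

text \<open>Gram-Schmidt keeps the first vector of its input. Starting it from a basis that begins
  with \<open>v\<close> and rescaling every output to unit length gives a unitary matrix whose first
  column is still parallel to \<open>v\<close>.\<close>

lemma unitary_completion: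
  fixes v :: "complex vec"
  assumes v: "v \<in> carrier_vec n" and v0: "v \<noteq> 0\<^sub>v n"
  shows "\<exists>W\<in>carrier_mat n n. mat_adjoint W * W = 1\<^sub>m n \<and> (\<exists>c. c \<noteq> 0 \<and> col W 0 = c \<cdot>\<^sub>v v)"
proof -
  interpret cof_vec_space n "TYPE(complex)" .
  have n: "0 < n" using v v0 by (cases n) auto
  note bc = basis_completion[OF v v0]
  define ws where "ws = gram_schmidt n (basis_completion v)"
  have ws: "set ws \<subseteq> carrier_vec n" "corthogonal ws" "length ws = n"
    using gram_schmidt_result[OF bc(2) bc(4) bc(5) ws_def] bc(6) by auto
  obtain vs where bv: "basis_completion v = v # vs"
    using bc(6,7) n by (cases "basis_completion v") auto
  have "hd ws = v"
    unfolding ws_def bv by (rule gram_schmidt_hd[OF v])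
  hence ws0: "ws ! 0 = v" using ws(3) n hd_conv_nth[of ws] by auto
  have wsc: "ws ! j \<in> carrier_vec n" if "j < n" for j
    using ws that by auto
  \<comment> \<open>\<open>corthogonal\<close> is an equivalence: besides orthogonality it says that
    no vector is orthogonal to itself, which is where \<open>rpos\<close> gets nonzero squared
    norms.\<close>
  have orth: "(\<Sum>k<n. cnj (ws ! i $ k) * (ws ! j $ k)) = 0 \<longleftrightarrow> i \<noteq> j" if "i < n" "j < n" for i j
  proof -
    have "ws ! j \<bullet>c ws ! i = (\<Sum>k<n. cnj (ws ! i $ k) * (ws ! j $ k))"
      using wsc[OF that(1)] wsc[OF that(2)]
      by (auto simp: scalar_prod_def atLeast0LessThan mult.commute intro!: sum.cong)
    thus ?thesis using corthogonalD[OF ws(2), of j i] that ws(3) by auto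
  qed
  define r where "r j = (\<Sum>k<n. (cmod (ws ! j $ k))\<^sup>2)" for j
  have r: "(\<Sum>k<n. cnj (ws ! j $ k) * (ws ! j $ k)) = of_real (r j)" for j
    by (simp only: r_def of_real_sum complex_norm_square) (simp add: mult.commute)
  have rpos: "r j > 0" if "j < n" for j
  proof -
    have "r j \<noteq> 0" using orth[OF that that] r[of j] by auto
    moreover have "r j \<ge> 0" by (simp add: r_def sum_nonneg)
    ultimately show ?thesis by simp
  qed
  \<comment> \<open>The scale factors are real, so conjugation fixes them and they leave the Gram
    entries as \<open>c i * c j\<close>.\<close>
  define c where "c j = complex_of_real (1 / sqrt (r j))" for j
  define W where "W = mat n n (\<lambda>(i, j). c j * ws ! j $ i)"
  have W: "W \<in> carrier_mat n n" by (simp add: W_def)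
  have "mat_adjoint W * W = 1\<^sub>m n"
  proof (rule eq_matI)
    fix i j assume "i < dim_row (1\<^sub>m n :: complex mat)" "j < dim_col (1\<^sub>m n :: complex mat)"
    hence ij: "i < n" "j < n" by auto
    have "(mat_adjoint W * W) $$ (i, j) = c i * c j * (\<Sum>k<n. cnj (ws ! i $ k) * (ws ! j $ k))"
      unfolding mat_adjoint_mult_self_index[OF W ij] sum_distrib_left
      using ij by (intro sum.cong) (auto simp: W_def c_def)
    also have "\<dots> = (if i = j then 1 else 0)"
    proof (cases "i = j")
      case True
      have "c j * c j * of_real (r j) = of_real (1 / sqrt (r j) * (1 / sqrt (r j)) * r j)"
        by (simp only: c_def of_real_mult)
      also have "1 / sqrt (r j) * (1 / sqrt (r j)) * r j = 1"
        using rpos[OF ij(2)] by (simp add: field_simps)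
      finally show ?thesis using True r by simp
    next
      case False
      thus ?thesis using orth[OF ij] by simp
    qed
    finally show "(mat_adjoint W * W) $$ (i, j) = 1\<^sub>m n $$ (i, j)" using ij by simp
  qed (use W in auto)
  moreover have "c 0 \<noteq> 0" using rpos[OF n] by (simp add: c_def)
  moreover have "col W 0 = c 0 \<cdot>\<^sub>v v"
    using v n ws0 by (intro eq_vecI) (auto simp: W_def)
  ultimately show ?thesis using W by blast
qed

lemma mat_adjoint_four_block:
  fixes A B C D :: "complex mat"
  assumes "A \<in> carrier_mat m k" "B \<in> carrier_mat m l" "C \<in> carrier_mat n k" "D \<in> carrier_mat n l"
  shows "mat_adjoint (four_block_mat A B C D) =
    four_block_mat (mat_adjoint A) (mat_adjoint C) (mat_adjoint B) (mat_adjoint D)"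
  using assms by (intro eq_matI) auto

text \<open>Deflation: a unitary change of basis that starts with an eigenvector clears the rest of
  the first column, self-adjointness then clears the rest of the first row, and induction
  diagonalizes the remaining block.\<close>

theorem hermitian_spectral_decomposition:
  fixes A :: "complex mat"
  assumes "A \<in> carrier_mat n n" "mat_adjoint A = A"
  shows "\<exists>U\<in>carrier_mat n n. \<exists>d :: nat \<Rightarrow> real. mat_adjoint U * U = 1\<^sub>m n \<and>
           A = U * mat_diag n (\<lambda>i. of_real (d i)) * mat_adjoint U"
  using assms
proof (induction n arbitrary: A)
  case 0
  thus ?case by (intro bexI[of _ "1\<^sub>m 0"] exI[of _ "\<lambda>_. 0"]) auto
next
  case (Suc n A)
  note A = Suc.prems(1)
  note sq = mult_carrier_mat[of _ "Suc n" "Suc n" _ "Suc n"]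
    and assoc = assoc_mult_mat[of _ "Suc n" "Suc n" _ "Suc n" _ "Suc n"]
  obtain es where es: "char_poly A = (\<Prod>a\<leftarrow>es. [:- a, 1:])" "length es = Suc n"
    using char_poly_factorized[OF A] by blast
  then obtain e where "eigenvalue A e"
    unfolding eigenvalue_root_char_poly[OF A] by (cases es) auto
  then obtain v where v: "v \<in> carrier_vec (Suc n)" "v \<noteq> 0\<^sub>v (Suc n)" "A *\<^sub>v v = e \<cdot>\<^sub>v v"
    using A by (auto simp: eigenvalue_def eigenvector_def)
  obtain W c where W: "W \<in> carrier_mat (Suc n) (Suc n)" "mat_adjoint W * W = 1\<^sub>m (Suc n)"
    "c \<noteq> 0" "col W 0 = c \<cdot>\<^sub>v v"
    using unitary_completion[OF v(1,2)] by blast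
  have Wa: "mat_adjoint W \<in> carrier_mat (Suc n) (Suc n)" using W by auto
  have WW: "W * mat_adjoint W = 1\<^sub>m (Suc n)"
    using mat_mult_left_right_inverse[OF Wa W(1,2)] .
  define B where "B = mat_adjoint W * (A * W)"
  have B: "B \<in> carrier_mat (Suc n) (Suc n)"
    unfolding B_def using A W Wa by (intro mult_carrier_mat)
  have Bherm: "mat_adjoint B = B"
  proof -
    have "mat_adjoint B = mat_adjoint (A * W) * W"
      unfolding B_def using A W Wa by (subst mat_adjoint_mult) auto
    also have "\<dots> = mat_adjoint W * A * W"
      using A W Suc.prems(2) by (subst mat_adjoint_mult) auto
    also have "\<dots> = B" unfolding B_def using assoc[OF Wa A W(1)] .
    finally show ?thesis .
  qed
  have Bsym: "B $$ (j, i) = cnj (B $$ (i, j))" if "i < Suc n" "j < Suc n" for i j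
  proof -
    have "B $$ (j, i) = mat_adjoint B $$ (j, i)" by (simp add: Bherm)
    thus ?thesis using B that by simp
  qed
  \<comment> \<open>Column 0 of \<open>W\<close> is an eigenvector, so column 0 of \<open>B\<close>
    is \<open>e\<close> times column 0 of the identity \<open>mat_adjoint W * W\<close>.\<close>
  have Bcol: "B $$ (i, 0) = (if i = 0 then e else 0)" if i: "i < Suc n" for i
  proof -
    have "col (A * W) 0 = A *\<^sub>v col W 0" using A W by (intro eq_vecI) auto
    also have "\<dots> = e \<cdot>\<^sub>v col W 0"
      using A v by (simp add: W(4) mult_mat_vec smult_smult_assoc mult.commute)
    finally have "B $$ (i, 0) = row (mat_adjoint W) i \<bullet> (e \<cdot>\<^sub>v col W 0)"
      unfolding B_def using A W Wa i by simp
    also have "\<dots> = e * (row (mat_adjoint W) i \<bullet> col W 0)"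
      by (rule scalar_prod_smult_distrib[OF row_carrier_vec[OF i Wa] col_carrier_vec[OF _ W(1)]]) simp
    also have "row (mat_adjoint W) i \<bullet> col W 0 = (mat_adjoint W * W) $$ (i, 0)"
      using W(1) i by simp
    finally show ?thesis using i by (simp add: W(2))
  qed
  define C where "C = mat n n (\<lambda>(i, j). B $$ (Suc i, Suc j))"
  have C: "C \<in> carrier_mat n n" by (simp add: C_def)
  have "mat_adjoint C = C"
    by (intro eq_matI) (auto simp: C_def intro!: Bsym[symmetric])
  from Suc.IH[OF C this] obtain U d where U: "U \<in> carrier_mat n n" "mat_adjoint U * U = 1\<^sub>m n"
    and CU: "C = U * mat_diag n (\<lambda>i. of_real (d i)) * mat_adjoint U" by blast
  have Ua: "mat_adjoint U \<in> carrier_mat n n" using U by auto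
  \<comment> \<open>\<open>Re e\<close> loses nothing: \<open>e\<close> is a diagonal entry of the
    self-adjoint \<open>B\<close>, hence real (\<open>ereal\<close>).\<close>
  define d' where "d' i = (case i of 0 \<Rightarrow> Re e | Suc j \<Rightarrow> d j)" for i
  let ?z1 = "0\<^sub>m 1 n :: complex mat" and ?z2 = "0\<^sub>m n 1 :: complex mat"
  have adj0: "mat_adjoint (0\<^sub>m k l) = (0\<^sub>m l k :: complex mat)" for k l by (intro eq_matI) auto
  have adj1: "mat_adjoint (1\<^sub>m k) = (1\<^sub>m k :: complex mat)" for k by (intro eq_matI) auto
  \<comment> \<open>The unitary for the lower block, extended by 1 in the corner that is already
    split off.\<close>
  define P where "P = four_block_mat (1\<^sub>m 1) ?z1 ?z2 U"
  have P: "P \<in> carrier_mat (Suc n) (Suc n)"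
    using four_block_carrier_mat[of "1\<^sub>m 1 :: complex mat" 1 1 U n n ?z1 ?z2] U by (simp add: P_def)
  have Pa: "mat_adjoint P = four_block_mat (1\<^sub>m 1) ?z1 ?z2 (mat_adjoint U)"
    unfolding P_def using U by (subst mat_adjoint_four_block[of _ 1 1 _ n _ n]) (auto simp: adj0 adj1)
  have PP: "mat_adjoint P * P = 1\<^sub>m (Suc n)"
    unfolding Pa unfolding P_def
    using U Ua by (subst mult_four_block_mat[of _ 1 1 _ n _ n _ _ 1 _ n]) (auto)
  let ?E = "mat 1 1 (\<lambda>_. e)"
  let ?D = "mat_diag n (\<lambda>i. complex_of_real (d i))"
  have D: "?D \<in> carrier_mat n n" by (simp add: mat_diag_def)
  have ereal: "complex_of_real (Re e) = e"
    using Bsym[of 0 0] Bcol[of 0] by (simp add: complex_eq_iff)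
  have D': "mat_diag (Suc n) (\<lambda>i. of_real (d' i)) = four_block_mat ?E ?z1 ?z2 ?D"
    by (intro eq_matI) (auto simp: mat_diag_def d'_def ereal less_Suc_eq_0_disj split: nat.splits)
  let ?D' = "mat_diag (Suc n) (\<lambda>i. complex_of_real (d' i))"
  have D'c: "?D' \<in> carrier_mat (Suc n) (Suc n)" by (simp add: mat_diag_def)
  have PDP: "P * ?D' * mat_adjoint P = four_block_mat ?E ?z1 ?z2 C"
  proof -
    have "P * ?D' = four_block_mat ?E ?z1 ?z2 (U * ?D)"
      unfolding D' P_def
      using U D by (subst mult_four_block_mat[of _ 1 1 _ n _ n _ _ 1 _ n])
        (auto simp: left_mult_zero_mat[OF D])
    also have "\<dots> * mat_adjoint P = four_block_mat ?E ?z1 ?z2 C"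
      unfolding Pa CU
      using U Ua D by (subst mult_four_block_mat[of _ 1 1 _ n _ n _ _ 1 _ n])
        (auto simp: left_mult_zero_mat[OF Ua] right_mult_zero_mat[OF mult_carrier_mat[OF U(1) D]]
          left_add_zero_mat[OF mult_carrier_mat[OF mult_carrier_mat[OF U(1) D] Ua]])
    finally show ?thesis .
  qed
  also have "\<dots> = B"
  proof (rule eq_matI)
    fix i j assume "i < dim_row B" "j < dim_col B"
    hence ij: "i < Suc n" "j < Suc n" using B by auto
    \<comment> \<open>The first row is the conjugate of the first column, so it too vanishes outside
      the corner.\<close>
    have "B $$ (0, j) = (if j = 0 then e else 0)"
      using Bsym[of j 0] Bcol[OF ij(2)] Bcol[of 0] Bsym[of 0 0] ij by (auto split: if_splits)
    thus "four_block_mat ?E ?z1 ?z2 C $$ (i, j) = B $$ (i, j)"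
      using ij Bcol[OF ij(1)] by (auto simp: C_def)
  qed (use B in \<open>auto simp: C_def\<close>)
  finally have BP: "P * ?D' * mat_adjoint P = B" .
  define X where "X = W * P"
  have X: "X \<in> carrier_mat (Suc n) (Suc n)" using W P by (simp add: X_def)
  have Xa: "mat_adjoint X = mat_adjoint P * mat_adjoint W"
    unfolding X_def by (rule mat_adjoint_mult[OF W(1) P])
  have Pac: "mat_adjoint P \<in> carrier_mat (Suc n) (Suc n)" using P by auto
  note c = W(1) Wa P Pac D'c A B
  have "mat_adjoint X * X = mat_adjoint P * ((mat_adjoint W * W) * P)"
    unfolding Xa unfolding X_def using c by (simp add: assoc sq)
  also have "\<dots> = 1\<^sub>m (Suc n)" using P PP by (simp add: W(2))
  finally have XX: "mat_adjoint X * X = 1\<^sub>m (Suc n)" .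
  have "X * ?D' * mat_adjoint X = W * (P * ?D' * mat_adjoint P) * mat_adjoint W"
    unfolding Xa unfolding X_def using c by (simp add: assoc sq)
  also have "\<dots> = (W * mat_adjoint W) * A * (W * mat_adjoint W)"
    unfolding BP unfolding B_def
    using c by (simp add: assoc sq)
  also have "\<dots> = A" using A by (simp add: WW)
  finally show ?case using X XX by metis
qed

text \<open>The decomposition in coordinates, with \<open>u k\<close> the column \<open>k\<close> of
  \<open>U\<close>. Similarity to a diagonal matrix yields the characteristic polynomial, through
  which the \<open>d k\<close> are tied to the energy.\<close>

lemma hermitian_eigenbasis_expansion:
  fixes A :: "complex mat"
  assumes A: "A \<in> carrier_mat n n" and herm: "mat_adjoint A = A"
  shows "\<exists>(d :: nat \<Rightarrow> real) u. char_poly A = (\<Prod>k<n. [:- of_real (d k), 1:]) \<and>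
    (\<forall>i<n. \<forall>j<n. A $$ (i, j) = (\<Sum>k<n. of_real (d k) * (u k i * cnj (u k j)))) \<and>
    (\<forall>k<n. (\<Sum>i<n. (cmod (u k i))\<^sup>2) = 1)"
proof -
  obtain U d where U: "U \<in> carrier_mat n n" and UU: "mat_adjoint U * U = 1\<^sub>m n"
    and AU: "A = U * mat_diag n (\<lambda>i. of_real (d i)) * mat_adjoint U"
    using hermitian_spectral_decomposition[OF A herm] by blast
  let ?D = "mat_diag n (\<lambda>i. complex_of_real (d i))"
  have Ua: "mat_adjoint U \<in> carrier_mat n n" using U by auto
  have D: "?D \<in> carrier_mat n n" by simp
  have "U * mat_adjoint U = 1\<^sub>m n" using mat_mult_left_right_inverse[OF Ua U UU] .
  hence "similar_mat_wit A ?D U (mat_adjoint U)"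
    using A U Ua D UU AU by (intro similar_mat_witI[of _ _ n]) auto
  hence "char_poly A = char_poly ?D"
    by (intro char_poly_similar) (auto simp: similar_mat_def)
  also have "\<dots> = (\<Prod>a\<leftarrow>diag_mat ?D. [:- a, 1:])"
    by (rule char_poly_upper_triangular[OF D]) (auto simp: mat_diag_def)
  also have "\<dots> = (\<Prod>k\<leftarrow>[0..<n]. [:- of_real (d k), 1:])"
    unfolding diag_mat_def by (auto simp: mat_diag_def o_def intro!: arg_cong[of _ _ prod_list])
  also have "\<dots> = (\<Prod>k<n. [:- of_real (d k), 1:])"
    by (simp add: prod.distinct_set_conv_list[symmetric] atLeast0LessThan)
  finally have cp: "char_poly A = (\<Prod>k<n. [:- of_real (d k), 1:])" .
  have ent: "A $$ (i, j) = (\<Sum>k<n. of_real (d k) * (U $$ (i, k) * cnj (U $$ (j, k))))"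
    if "i < n" "j < n" for i j
    unfolding AU mat_diag_mult_right[OF U] using U that
    by (auto simp: scalar_prod_def atLeast0LessThan intro!: sum.cong)
  have nrm: "(\<Sum>i<n. (cmod (U $$ (i, k)))\<^sup>2) = 1" if "k < n" for k
  proof -
    have "complex_of_real (\<Sum>i<n. (cmod (U $$ (i, k)))\<^sup>2) = (\<Sum>i<n. cnj (U $$ (i, k)) * U $$ (i, k))"
      by (simp only: of_real_sum complex_norm_square) (simp add: mult.commute)
    also have "\<dots> = 1"
      using mat_adjoint_mult_self_index[OF U that that] UU that by simp
    finally show ?thesis by (simp only: of_real_eq_1_iff)
  qed
  show ?thesis
    by (intro exI[of _ d] exI[of _ "\<lambda>k i. U $$ (i, k)"] conjI allI impI cp ent nrm)
qed

section \<open>Multiplicities and energy from a factored characteristic polynomial\<close>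

lemma order_prod_linear:
  fixes c :: "'b \<Rightarrow> 'a :: field"
  assumes "finite K"
  shows "order \<mu> (\<Prod>k\<in>K. [:- c k, 1:]) = card {k \<in> K. c k = \<mu>}"
  using assms
proof (induction K rule: finite_induct)
  case empty
  thus ?case by (simp add: order_0I)
next
  case (insert k K)
  \<comment> \<open>Additivity of \<open>order\<close> requires a nonzero product.\<close>
  have "(\<Prod>k\<in>insert k K. [:- c k, 1:]) \<noteq> 0" using insert.hyps(1) by (subst prod_zero_iff) auto
  hence "order \<mu> (\<Prod>k\<in>insert k K. [:- c k, 1:]) =
      order \<mu> [:- c k, 1:] + card {k \<in> K. c k = \<mu>}"
    using insert by (subst prod.insert) (simp_all add: order_mult del: mult_pCons_left mult_pCons_right)
  moreover have "{j \<in> insert k K. c j = \<mu>} =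
      (if c k = \<mu> then insert k {k \<in> K. c k = \<mu>} else {k \<in> K. c k = \<mu>})" by auto
  moreover have "order \<mu> [:- c k, 1:] = (if c k = \<mu> then 1 else 0)"
    using order_power_n_n[of \<mu> 1] by (auto intro!: order_0I)
  ultimately show ?case using insert.hyps by simp
qed

text \<open>The multiplicity of an eigenvalue counts the indices \<open>k\<close> at which
  \<open>c\<close> takes that value, so grouping the sum over \<open>k\<close> by values recovers
  the definition.\<close>

lemma abs_eigenvalue_sum_factorized:
  assumes A: "A \<in> carrier_mat n n" and cp: "char_poly A = (\<Prod>k<n. [:- c k, 1:])"
  shows "abs_eigenvalue_sum A = (\<Sum>k<n. cmod (c k))"
proof -
  have "spectrum A = c ` {..<n}"
    by (auto simp: spectrum_root_char_poly[OF A] cp poly_prod)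
  hence "abs_eigenvalue_sum A = (\<Sum>\<mu>\<in>c ` {..<n}. \<Sum>k | k \<in> {..<n} \<and> c k = \<mu>. cmod (c k))"
    unfolding abs_eigenvalue_sum_def cp by (simp add: order_prod_linear)
  also have "\<dots> = (\<Sum>k<n. cmod (c k))"
    by (rule sum.image_gen[symmetric]) simp
  finally show ?thesis .
qed


section \<open>The energy bound\<close>

text \<open>Triangle inequality, then Cauchy-Schwarz. Applied to each clique, this is the source of
  \<open>X \<le> I\<close>.\<close>

lemma norm_sum_squared_le:
  fixes f :: "'b \<Rightarrow> complex"
  shows "(cmod (\<Sum>i\<in>S. f i))\<^sup>2 \<le> real (card S) * (\<Sum>i\<in>S. (cmod (f i))\<^sup>2)"
proof -
  have "(cmod (\<Sum>i\<in>S. f i))\<^sup>2 \<le> (\<Sum>i\<in>S. cmod (f i))\<^sup>2"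
    by (intro power_mono norm_sum) simp
  also have "\<dots> \<le> (\<Sum>i\<in>S. (cmod (f i))\<^sup>2) * real (card S)"
    by (rule sum_squared_le_sum_of_squares)
  finally show ?thesis by (simp add: mult.commute)
qed

text \<open>Each term is at most the positive part \<open>(\<bar>d k\<bar> + d k) / 2\<close>, and
  the second halves cancel in the sum. For eigenvalues this is where the zero trace enters.\<close>

lemma weighted_sum_le_half_abs_sum:
  fixes d c :: "'b \<Rightarrow> real"
  assumes "\<And>k. k \<in> K \<Longrightarrow> 0 \<le> c k" "\<And>k. k \<in> K \<Longrightarrow> c k \<le> 1" "(\<Sum>k\<in>K. d k) = 0"
  shows "(\<Sum>k\<in>K. d k * c k) \<le> 1 / 2 * (\<Sum>k\<in>K. \<bar>d k\<bar>)"
proof -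
  have "(\<Sum>k\<in>K. d k * c k) \<le> (\<Sum>k\<in>K. 1 / 2 * (\<bar>d k\<bar> + d k))"
  proof (rule sum_mono)
    fix k assume "k \<in> K"
    hence c: "0 \<le> c k" "c k \<le> 1" using assms by auto
    show "d k * c k \<le> 1 / 2 * (\<bar>d k\<bar> + d k)"
    proof (cases "d k \<ge> 0")
      case True thus ?thesis using mult_left_le[OF c(2)] by simp
    next
      case False thus ?thesis using c by (simp add: mult_nonpos_nonneg)
    qed
  qed
  also have "\<dots> = 1 / 2 * (\<Sum>k\<in>K. \<bar>d k\<bar>)"
    unfolding sum_distrib_left[symmetric] sum.distrib assms(3) by simp
  finally show ?thesis .
qed

lemma mat_adjoint_adj_matrix: "mat_adjoint (adj_matrix E vs) = adj_matrix E vs"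
  by (intro eq_matI) (auto simp: adj_matrix_def insert_commute)

text \<open>Every feasible weighting gives a bound; a minimizer gives the sharpest one.\<close>

theorem energy_ge_frac_partition:
  fixes V :: "'a set"
  assumes G: "fin_graph V E" and y: "y \<in> frac_partitions V (cliques V E)"
  shows "real (card V) - (\<Sum>U\<in>cliques V E. y U) \<le> 1 / 2 * energy V E"
proof -
  let ?C = "cliques V E"
  have finV: "finite V" and E: "E \<subseteq> [V]\<^bsup>2\<^esup>" using G by (auto simp: fin_graph_def)
  have finC: "finite ?C" using finV by (auto simp: cliques_def)
  obtain vs where vs: "distinct vs" "set vs = V" using finite_distinct_list[OF finV] by blast
  define n where "n = length vs"
  have n: "card V = n" using vs distinct_card by (auto simp: n_def)
  define A where "A = adj_matrix E vs"
  have A: "A \<in> carrier_mat n n" by (simp add: A_def n_def)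
  have herm: "mat_adjoint A = A" by (simp add: A_def mat_adjoint_adj_matrix)
  obtain d u where cp: "char_poly A = (\<Prod>k<n. [:- of_real (d k), 1:])"
    and ent: "\<forall>i<n. \<forall>j<n. A $$ (i, j) = (\<Sum>k<n. of_real (d k) * (u k i * cnj (u k j)))"
    and nrm: "\<forall>k<n. (\<Sum>i<n. (cmod (u k i))\<^sup>2) = 1"
    using hermitian_eigenbasis_expansion[OF A herm] by blast
  have energy: "energy V E = (\<Sum>k<n. \<bar>d k\<bar>)"
    using energy_eq[OF vs, of E] abs_eigenvalue_sum_factorized[OF A cp] by (simp add: A_def)
  have noloop: "{v} \<notin> E" for v using E by (auto simp: nsets_def)
  have Aii: "A $$ (i, i) = 0" if "i < n" for i
    using that noloop by (simp add: A_def adj_matrix_def n_def)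
  \<comment> \<open>The quadratic form of \<open>A\<close> at the indicator vector of
    \<open>S\<close>, written in the eigenbasis. Singletons give the diagonal entries used in
    \<open>trace\<close>, cliques give \<open>clique_quad\<close>.\<close>
  have quad: "(\<Sum>i\<in>S. \<Sum>j\<in>S. A $$ (i, j)) =
      of_real (\<Sum>k<n. d k * (cmod (\<Sum>i\<in>S. u k i))\<^sup>2)" if "S \<subseteq> {..<n}" for S
  proof -
    have "(\<Sum>i\<in>S. \<Sum>j\<in>S. A $$ (i, j)) =
        (\<Sum>i\<in>S. \<Sum>j\<in>S. \<Sum>k<n. of_real (d k) * (u k i * cnj (u k j)))"
      using that by (intro sum.cong refl ent[rule_format]) auto
    also have "\<dots> = (\<Sum>i\<in>S. \<Sum>k<n. \<Sum>j\<in>S. of_real (d k) * (u k i * cnj (u k j)))"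
      by (intro sum.cong refl sum.swap)
    also have "\<dots> = (\<Sum>k<n. \<Sum>i\<in>S. \<Sum>j\<in>S. of_real (d k) * (u k i * cnj (u k j)))"
      by (rule sum.swap)
    also have "\<dots> = (\<Sum>k<n. of_real (d k) * ((\<Sum>i\<in>S. u k i) * cnj (\<Sum>i\<in>S. u k i)))"
      by (simp only: cnj_sum sum_product) (simp only: sum_distrib_left)
    finally show ?thesis by (simp only: complex_norm_square of_real_sum of_real_mult)
  qed
  have trace: "(\<Sum>k<n. d k) = 0"
  proof -
    \<comment> \<open>Unit norm spreads each \<open>d k\<close> over the coordinates of
      \<open>u k\<close>; exchanging the sums collects the diagonal entries of
      \<open>A\<close>.\<close>
    have "(\<Sum>k<n. d k) = (\<Sum>k<n. \<Sum>i<n. d k * (cmod (u k i))\<^sup>2)"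
      using nrm by (simp add: sum_distrib_left[symmetric])
    also have "\<dots> = (\<Sum>i<n. \<Sum>k<n. d k * (cmod (u k i))\<^sup>2)" by (rule sum.swap)
    also have "\<dots> = 0"
    proof (rule sum.neutral, rule ballI)
      fix i assume "i \<in> {..<n}"
      hence "complex_of_real (\<Sum>k<n. d k * (cmod (u k i))\<^sup>2) = 0"
        using quad[of "{i}"] Aii[of i] by simp
      thus "(\<Sum>k<n. d k * (cmod (u k i))\<^sup>2) = 0" by (simp only: of_real_eq_0_iff)
    qed
    finally show ?thesis .
  qed
  have y1: "(\<Sum>U\<in>?C. of_bool (v \<in> U) * y U) = 1" if "v \<in> V" for v
    using y that by (auto simp: frac_partitions_def)
  have y0: "0 \<le> y U" if "U \<in> ?C" for U using y that by (auto simp: frac_partitions_def)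
  \<comment> \<open>Matrix indices are positions in \<open>vs\<close>, so a clique is replaced by
    its set of positions.\<close>
  define I where "I U = {i. i < n \<and> vs ! i \<in> U}" for U
  have I: "I U \<subseteq> {..<n}" "finite (I U)" for U by (auto simp: I_def)
  have vsV: "vs ! i \<in> V" if "i < n" for i using that vs by (auto simp: n_def)
  \<comment> \<open>The constraint \<open>M y = 1\<close> integrated against \<open>f\<close>. The
    constant 1 gives \<open>n\<close> as the \<open>y\<close>-weighted sum of clique sizes; the
    squared moduli of the coordinates of \<open>u k\<close> give \<open>c k \<le> 1\<close>.\<close>
  have cover: "(\<Sum>U\<in>?C. y U * (\<Sum>i\<in>I U. f i)) = (\<Sum>i<n. f i)" for f :: "nat \<Rightarrow> real"
  proof -
    have "(\<Sum>i\<in>I U. f i) = (\<Sum>i<n. of_bool (vs ! i \<in> U) * f i)" for U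
      unfolding I_def by (intro sum.mono_neutral_cong_left) auto
    hence "(\<Sum>U\<in>?C. y U * (\<Sum>i\<in>I U. f i)) = (\<Sum>U\<in>?C. \<Sum>i<n. f i * (of_bool (vs ! i \<in> U) * y U))"
      by (simp only: sum_distrib_left mult_ac)
    also have "\<dots> = (\<Sum>i<n. f i * (\<Sum>U\<in>?C. of_bool (vs ! i \<in> U) * y U))"
      by (subst sum.swap) (simp only: sum_distrib_left)
    also have "\<dots> = (\<Sum>i<n. f i)" using y1 vsV by simp
    finally show ?thesis .
  qed
  define q where "q k U = (cmod (\<Sum>i\<in>I U. u k i))\<^sup>2" for k U
  \<comment> \<open>On a clique \<open>A\<close> is the all-ones matrix minus the identity, so each
    row sums to the clique size minus 1.\<close>
  have clique_quad: "(\<Sum>k<n. d k * q k U) = real (card (I U)) * (real (card (I U)) - 1)"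
    if U: "U \<in> ?C" for U
  proof -
    have "(\<Sum>j\<in>I U. A $$ (i, j)) = of_real (real (card (I U)) - 1)" if i: "i \<in> I U" for i
    proof -
      have "A $$ (i, j) = 1" if j: "j \<in> I U - {i}" for j
      proof -
        have "vs ! i \<noteq> vs ! j"
          using i j vs(1) by (auto simp: I_def n_def nth_eq_iff_index_eq)
        hence "{vs ! i, vs ! j} \<in> E"
          using U i j by (auto simp: I_def cliques_def clique_def)
        thus ?thesis using i j by (auto simp: A_def adj_matrix_def I_def n_def)
      qed
      hence "(\<Sum>j\<in>I U. A $$ (i, j)) = of_nat (card (I U - {i}))"
        using i I(2)[of U] Aii[of i] by (subst sum.remove[of _ i]) (auto simp: I_def)
      \<comment> \<open>Rules out truncated subtraction when the size minus 1 is cast from the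
        naturals.\<close>
      moreover have "card (I U) \<noteq> 0" using i I(2)[of U] by auto
      ultimately show ?thesis using i I(2)[of U] by (simp add: of_nat_diff)
    qed
    hence "complex_of_real (\<Sum>k<n. d k * q k U) =
        of_real (real (card (I U)) * (real (card (I U)) - 1))"
      using quad[OF I(1)[of U]] by (simp add: q_def)
    thus ?thesis by (simp only: of_real_eq_iff)
  qed
  \<comment> \<open>The empty clique contributes \<open>0\<close> since \<open>x / 0 = 0\<close>.\<close>
  define c where "c k = (\<Sum>U\<in>?C. y U / real (card (I U)) * q k U)" for k
  have c0: "0 \<le> c k" for k
    unfolding c_def q_def using y0 by (intro sum_nonneg mult_nonneg_nonneg divide_nonneg_nonneg) auto
  have c1: "c k \<le> 1" if "k < n" for k
  proof -
    \<comment> \<open>Cauchy-Schwarz cancels the divisor \<open>card (I U)\<close>;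
      \<open>cover\<close> and the unit norm of \<open>u k\<close> then evaluate the right side to
      1.\<close>
    have "c k \<le> (\<Sum>U\<in>?C. y U * (\<Sum>i\<in>I U. (cmod (u k i))\<^sup>2))"
      unfolding c_def
    proof (rule sum_mono)
      fix U assume U: "U \<in> ?C"
      show "y U / real (card (I U)) * q k U \<le> y U * (\<Sum>i\<in>I U. (cmod (u k i))\<^sup>2)"
      proof (cases "card (I U) = 0")
        case True
        thus ?thesis using y0[OF U] by (simp add: sum_nonneg)
      next
        case False
        have "y U / real (card (I U)) * q k U \<le>
            y U / real (card (I U)) * (real (card (I U)) * (\<Sum>i\<in>I U. (cmod (u k i))\<^sup>2))"
          unfolding q_def using y0[OF U] by (intro mult_left_mono norm_sum_squared_le) auto
        thus ?thesis using False by simp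
      qed
    qed
    thus ?thesis using cover nrm[rule_format, OF that] by simp
  qed
  have "real n - (\<Sum>U\<in>?C. y U) = (\<Sum>U\<in>?C. y U * (real (card (I U)) - 1))"
    using cover[of "\<lambda>_. 1"] by (simp add: right_diff_distrib sum_subtractf)
  \<comment> \<open>Nonempty cliques give equality; the empty one gives \<open>- y U\<close> on the
    left and 0 on the right.\<close>
  also have "\<dots> \<le> (\<Sum>U\<in>?C. y U / real (card (I U)) * (\<Sum>k<n. d k * q k U))"
    using y0 by (intro sum_mono) (auto simp: clique_quad)
  \<comment> \<open>Both sides are the trace of \<open>A X\<close>, first clique by clique, then
    eigenvector by eigenvector.\<close>
  also have "\<dots> = (\<Sum>k<n. d k * c k)"
    unfolding c_def sum_distrib_left by (subst sum.swap) (simp add: mult_ac)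
  also have "\<dots> \<le> 1 / 2 * (\<Sum>k<n. \<bar>d k\<bar>)"
    using c0 c1 trace by (intro weighted_sum_le_half_abs_sum) auto
  finally show ?thesis by (simp add: energy n)
qed

theorem theorem1p3:
  fixes V :: "'a set" and E :: "'a set set" and n :: nat
  assumes "fin_graph V E" and "card V = n"
  shows "1 / 2 * energy V E \<ge> real n - frac_chromatic V (compl_edges V E)"
proof -
  have "finite V" using assms by (simp add: fin_graph_def)
  \<comment> \<open>The minimum is attained, and the independent sets of the complement are the
    cliques of the graph.\<close>
  then obtain y where "y \<in> frac_partitions V (cliques V E)"
    "(\<Sum>U\<in>cliques V E. y U) = frac_chromatic V (compl_edges V E)"
    using frac_chromatic_attained[of V "compl_edges V E"] by (auto simp: indep_sets_compl)
  thus ?thesis using energy_ge_frac_partition[OF assms(1)] assms(2) by metis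
qed

end
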